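(* The dual $\left(K_5^{(3)}\right)^\star$ of $K_5^{(3)}$ is, up to isomorphism, the unique uniform Šoltés' hypergraph of minimum size. That is, $\left(K_5^{(3)}\right)^\star$ is a uniform Šoltés' hypergraph, every uniform Šoltés' hypergraph has at least as many edges as $\left(K_5^{(3)}\right)^\star$, and every uniform Šoltés' hypergraph with the same number of edges as $\left(K_5^{(3)}\right)^\star$ is isomorphic to it.
   Context: A hypergraph $H=(V,E)$ consists of a finite vertex set $V$ and a set $E\subseteq 2^V$ of (hyper)edges, each edge being a set of at least two vertices ($E$ is a set, so there are no repeated edges). Its order is $|V|$ and its size is $|E|$. It is uniform if all its edges have the same number of elements. $K_n^{(r)}=\left([n],\binom{[n]}{r}\right)$ is the hypergraph on $[n]=\{1,\ldots,n\}$ whose edges are all $r$-element subsets of $[n]$. The dual $H^\star$ of $H=(V,E)$ is the hypergraph whose vertices are the edges of $H$ and whose edges are the sets $\{e\in E: x\in e\}$ for $x\in V$. For $v\in V$, $H\setminus v$ denotes the hypergraph with vertex set $V\setminus\{v\}$ whose edges are exactly the edges of $H$ that do not contain $v$. The distance $d(u,v)$ is the length $r$ of a shortest path $(v_0,e_1,v_1,\ldots,e_r,v_r)$ with $v_0=u$, $v_r=v$ and each $e_i$ an edge containing $v_{i-1}$ and $v_i$, no vertex or edge being repeated; it is infinite if there is no such path. $H$ is connected if all distances are finite. The total distance is $W(H)=\sum d(u,v)$, summed over all unordered pairs of distinct vertices. A Šoltés' hypergraph is a connected hypergraph $H$ such that $W(H\setminus v)$ is finite and $W(H)=W(H\setminus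 v)$ for every $v\in V$; by convention the one-vertex hypergraph $K_1$ is not a Šoltés' hypergraph, so a Šoltés' hypergraph has at least two vertices. *)

theory Defs
  imports Main "HOL-Library.Extended_Nat"
begin

datatype 'a hypergraph = Hypergraph (verts: "'a set") (edges: "'a set set")

definition wf_hypergraph :: "'a hypergraph \<Rightarrow> bool" where
  "wf_hypergraph H \<longleftrightarrow>
     finite (verts H) \<and> (\<forall>e \<in> edges H. e \<subseteq> verts H \<and> card e \<ge> 2)"

definition hsize :: "'a hypergraph \<Rightarrow> nat" where
  "hsize H = card (edges H)"

definition uniform :: "'a hypergraph \<Rightarrow> bool" where
  "uniform H \<longleftrightarrow> (\<exists>r. \<forall>e \<in> edges H. card e = r)"

definition complete_uniform :: "nat \<Rightarrow> nat \<Rightarrow> nat hypergraph" where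
  "complete_uniform n r = Hypergraph {1..n} {e. e \<subseteq> {1..n} \<and> card e = r}"

definition dual :: "'a hypergraph \<Rightarrow> 'a set hypergraph" where
  "dual H = Hypergraph (edges H) ((\<lambda>x. {e \<in> edges H. x \<in> e}) ` verts H)"

definition delete_vertex :: "'a hypergraph \<Rightarrow> 'a \<Rightarrow> 'a hypergraph" where
  "delete_vertex H v = Hypergraph (verts H - {v}) {e \<in> edges H. v \<notin> e}"

definition is_path :: "'a hypergraph \<Rightarrow> 'a list \<Rightarrow> 'a set list \<Rightarrow> bool" where
  "is_path H vs es \<longleftrightarrow>
     length vs = Suc (length es) \<and> set vs \<subseteq> verts H \<and> set es \<subseteq> edges H \<and>
     distinct vs \<and> distinct es \<and>
     (\<forall>i < length es. vs ! i \<in> es ! i \<and> vs ! Suc i \<in> es ! i)"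

text \<open>The infimum of the empty set in \<^typ>\<open>enat\<close> is \<open>\<infinity>\<close>.\<close>

definition hdist :: "'a hypergraph \<Rightarrow> 'a \<Rightarrow> 'a \<Rightarrow> enat" where
  "hdist H u v =
     Inf {enat (length es) | vs es. is_path H vs es \<and> hd vs = u \<and> last vs = v}"

definition hconnected :: "'a hypergraph \<Rightarrow> bool" where
  "hconnected H \<longleftrightarrow> (\<forall>u \<in> verts H. \<forall>v \<in> verts H. hdist H u v \<noteq> \<infinity>)"

text \<open>Distance as a function of an unordered pair; well defined by symmetry, see
  \<open>pair_dist_doubleton\<close>.\<close>

definition pair_dist :: "'a hypergraph \<Rightarrow> 'a set \<Rightarrow> enat" where
  "pair_dist H P = (THE d. \<exists>u v. P = {u, v} \<and> d = hdist H u v)"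

definition total_dist :: "'a hypergraph \<Rightarrow> enat" where
  "total_dist H = (\<Sum>P \<in> {P. P \<subseteq> verts H \<and> card P = 2}. pair_dist H P)"

text \<open>The cardinality condition excludes the one-vertex hypergraph (and the empty one), for
  which the remaining conditions hold trivially.\<close>

definition soltes :: "'a hypergraph \<Rightarrow> bool" where
  "soltes H \<longleftrightarrow>
     wf_hypergraph H \<and> card (verts H) \<ge> 2 \<and> hconnected H \<and>
     (\<forall>v \<in> verts H. total_dist (delete_vertex H v) \<noteq> \<infinity> \<and>
                    total_dist H = total_dist (delete_vertex H v))"

definition isomorphic :: "'a hypergraph \<Rightarrow> 'b hypergraph \<Rightarrow> bool" where
  "isomorphic G H \<longleftrightarrow>
     (\<exists>f. bij_betw f (verts G) (verts H) \<and> (\<lambda>e. f ` e) ` edges G = edges H)"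

lemma is_path_rev:
  assumes "is_path H vs es"
  shows "is_path H (rev vs) (rev es)"
proof -
  have len: "length vs = Suc (length es)"
    and inc: "\<And>i. i < length es \<Longrightarrow> vs ! i \<in> es ! i \<and> vs ! Suc i \<in> es ! i"
    using assms by (auto simp: is_path_def)
  have "rev vs ! i \<in> rev es ! i \<and> rev vs ! Suc i \<in> rev es ! i" if i: "i < length es" for i
  proof -
    let ?j = "length es - Suc i"
    have "?j < length es" "Suc ?j = length es - i" using i by auto
    then show ?thesis using inc[of ?j] i len by (simp add: rev_nth)
  qed
  then show ?thesis using assms by (auto simp: is_path_def)
qed

lemma hdist_sym: "hdist H u v = hdist H v u"
proof -
  have le: "{enat (length es) | vs es. is_path H vs es \<and> hd vs = u \<and> last vs = v}
      \<subseteq> {enat (length es) | vs es. is_path H vs es \<and> hd vs = v \<and> last vs = u}" for u v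
  proof clarify
    fix vs es assume p: "is_path H vs es"
    then have "vs \<noteq> []" by (auto simp: is_path_def)
    then show "\<exists>vs' es'. enat (length es) = enat (length es') \<and>
        is_path H vs' es' \<and> hd vs' = last vs \<and> last vs' = hd vs"
      using is_path_rev[OF p]
      by (intro exI[of _ "rev vs"] exI[of _ "rev es"]) (simp add: hd_rev last_rev)
  qed
  show ?thesis unfolding hdist_def using le[of u v] le[of v u] by (simp add: subset_antisym)
qed

lemma pair_dist_doubleton: "pair_dist H {u, v} = hdist H u v"
  unfolding pair_dist_def by (rule the_equality) (auto simp: doubleton_eq_iff hdist_sym)

end

theory Submission
  imports Defs
begin

text \<open>
  Each vertex \<open>v\<close> is identified with its star \<open>S v\<close>, the set of edges through it. If
  \<open>S u \<subseteq> S v\<close> for some \<open>u \<noteq> v\<close>, then \<open>u\<close> is isolated after the deletion of \<open>v\<close>; so in a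
  Soltes hypergraph the stars form an antichain of distinct subsets of the edge set
  (\<open>soltes_star_antichain\<close>), and the uniformity \<open>card e = r\<close> says that every edge lies in
  exactly \<open>r\<close> members of this antichain.

  The distance condition enters through one inequality. With \<open>n\<close> vertices and \<open>N H\<close> pairs of
  vertices that share no edge, the total distance is at least \<open>(n choose 2) + N H\<close>; if no
  distance after the deletion of \<open>v\<close> exceeds \<open>d + 1\<close>, the total distance after the deletion is
  at most \<open>(n - 1 choose 2) + d * N (H - v)\<close>. Equality of the two total distances therefore gives
  \<open>n - 1 + N H \<le> d * N (H - v)\<close> (\<open>soltes_far_pairs\<close>). As a path does not repeat edges,
  \<open>d + 1\<close> may be taken to be the number of edges that avoid \<open>v\<close>. This and the antichain property
  show that every star has at least two elements and misses at least two edges, so that there are at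
  least four edges.

  Suppose that exactly two edges \<open>a\<close>, \<open>b\<close> avoid \<open>v\<close>. By uniformity \<open>a - b\<close> and \<open>b - a\<close> have the
  same size \<open>p\<close>; with \<open>c = card (a \<inter> b)\<close> the inequality becomes \<open>2 * p + c + N H \<le> p * p\<close>
  (\<open>soltes_two_remaining_edges\<close>). With four edges all stars have size 2, double counting of
  incidences gives \<open>c = 1\<close>, hence \<open>p \<ge> 3\<close>, and there are more vertices than 2-subsets of a 4-set.

  With five edges all stars have size 2 or 3. If all have size 2, the hypergraph is the dual of a
  2-regular or 4-regular graph on five vertices, and counting adjacent pairs contradicts the
  inequality (\<open>soltes_5_edges_card_star_3\<close>). Otherwise some star \<open>S v\<close> has size 3, and the stars of
  the vertices in \<open>a - b\<close>, with \<open>a\<close> removed, form an antichain of proper nonempty subsets of this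
  3-set. Hence \<open>p \<le> 3\<close>; the inequality and the double counting of incidences leave \<open>p = 3\<close>, and
  the antichain consists of all singletons or of all 2-subsets. Singletons, for \<open>a\<close> or for \<open>b\<close>,
  produce too many pairs that share no edge or too many stars of size 3; 2-subsets for both edges
  force \<open>c = 3\<close> and all stars of size 3 (\<open>soltes_star_image_eq_triples\<close>). So the stars are all ten
  3-subsets of the edge set, which describes the dual of the complete 3-uniform hypergraph on five
  vertices.
\<close>

section \<open>Total distance and pairs of vertices without a common edge\<close>

definition star :: "'a hypergraph \<Rightarrow> 'a \<Rightarrow> 'a set set" where
  "star H v = {e \<in> edges H. v \<in> e}"

definition far_pairs :: "'a hypergraph \<Rightarrow> 'a set set" where
  "far_pairs H = {P. P \<subseteq> verts H \<and> card P = 2 \<and> (\<forall>e \<in> edges H. \<not> P \<subseteq> e)}"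

lemma hdist_le_path:
  assumes "is_path H vs es" "hd vs = u" "last vs = w"
  shows "hdist H u w \<le> enat (length es)"
  unfolding hdist_def using assms by (intro Inf_lower) auto

lemma hdist_refl:
  assumes "u \<in> verts H"
  shows "hdist H u u = 0"
proof -
  have "is_path H [u] []" using assms by (simp add: is_path_def)
  from hdist_le_path[OF this, of u u] show ?thesis by (simp flip: zero_enat_def)
qed

lemma hdist_le_1:
  assumes "e \<in> edges H" "{u, w} \<subseteq> e" "{u, w} \<subseteq> verts H" "u \<noteq> w"
  shows "hdist H u w \<le> 1"
proof -
  have "is_path H [u, w] [e]" using assms by (auto simp: is_path_def)
  from hdist_le_path[OF this] show ?thesis by (simp add: one_enat_def)
qed

lemma hdist_le_2:
  assumes "e \<in> edges H" "f \<in> edges H" "u \<in> e" "w \<in> f" "x \<in> e \<inter> f"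
    and V: "{u, w, x} \<subseteq> verts H" and "u \<noteq> w"
  shows "hdist H u w \<le> enat 2"
proof (cases "w \<in> e \<or> u \<in> f")
  case True
  then have "hdist H u w \<le> 1" using assms hdist_le_1[of e H u w] hdist_le_1[of f H u w] by auto
  then show ?thesis by (rule order_trans) (simp add: one_enat_def)
next
  case False
  then have "is_path H [u, x, w] [e, f]"
    using assms by (auto simp: is_path_def less_Suc_eq nth_Cons')
  from hdist_le_path[OF this] show ?thesis by (simp add: numeral_2_eq_2)
qed

lemma is_path_first_edge:
  assumes p: "is_path H vs es" and "hd vs \<noteq> last vs"
  obtains e where "e \<in> edges H" "hd vs \<in> e" "length es \<ge> 1" "length es = 1 \<Longrightarrow> last vs \<in> e"
proof -
  have len: "length vs = Suc (length es)" using p by (simp add: is_path_def)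
  have ne: "es \<noteq> []" using len assms(2) by (cases vs) auto
  then have 0: "0 < length es" by simp
  have "es ! 0 \<in> edges H" using p nth_mem[OF 0] by (auto simp: is_path_def)
  moreover have "vs ! 0 \<in> es ! 0 \<and> vs ! Suc 0 \<in> es ! 0" using p 0 by (auto simp: is_path_def)
  moreover have "hd vs = vs ! 0" using len by (intro hd_conv_nth) auto
  moreover have "last vs = vs ! length es" using len by (subst last_conv_nth) auto
  moreover have "length es \<ge> 1" using ne by (cases es) auto
  ultimately show ?thesis by (intro that[of "es ! 0"]) auto
qed

lemma hdist_ge_1:
  assumes "u \<noteq> w"
  shows "1 \<le> hdist H u w"
  unfolding hdist_def
proof (intro Inf_greatest, clarify)
  fix vs es assume "is_path H vs es" "u = hd vs" "w = last vs"
  with assms show "1 \<le> enat (length es)"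
    by (metis is_path_first_edge enat_ord_simps(1) one_enat_def)
qed

lemma hdist_ge_2:
  assumes "u \<noteq> w" "\<forall>e \<in> edges H. \<not> {u, w} \<subseteq> e"
  shows "enat 2 \<le> hdist H u w"
  unfolding hdist_def
proof (intro Inf_greatest, clarify)
  fix vs es assume p: "is_path H vs es" and "u = hd vs" "w = last vs"
  with assms obtain e where e: "e \<in> edges H" "u \<in> e" "length es \<ge> 1" "length es = 1 \<Longrightarrow> w \<in> e"
    by (metis is_path_first_edge)
  then have "length es \<noteq> 1" using assms(2) by auto
  with e show "enat 2 \<le> enat (length es)" by simp
qed

text \<open>A path between distinct vertices starts with an edge at its first vertex, so the infimum that
  defines the distance is over the empty set.\<close>

lemma hdist_isolated:
  assumes "u \<noteq> w" "star H u = {}"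
  shows "hdist H u w = \<infinity>"
proof -
  have "{enat (length es) | vs es. is_path H vs es \<and> hd vs = u \<and> last vs = w} = {}"
    using assms by (auto simp: star_def elim!: is_path_first_edge)
  then show ?thesis unfolding hdist_def by (simp add: Inf_enat_def)
qed

text \<open>A shortest path does not repeat edges, so its length is a number of distinct edges.\<close>

lemma hdist_le_card_edges:
  assumes "finite (edges H)" "hdist H u w \<noteq> \<infinity>"
  shows "hdist H u w \<le> enat (card (edges H))"
proof -
  let ?L = "{enat (length es) | vs es. is_path H vs es \<and> hd vs = u \<and> last vs = w}"
  have "?L \<noteq> {}" using assms(2) unfolding hdist_def by (metis Inf_enat_def)
  then obtain vs es where p: "is_path H vs es" "hd vs = u" "last vs = w" by auto
  then have "length es = card (set es)" by (auto simp: is_path_def distinct_card)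
  also have "\<dots> \<le> card (edges H)"
    using p assms(1) by (intro card_mono) (auto simp: is_path_def)
  finally show ?thesis using hdist_le_path[OF p] by (meson enat_ord_simps(1) order_trans)
qed

text \<open>Both bounds on the total distance compare it with the sum that gives weight 1 to a pair with a
  common edge and weight \<open>1 + d\<close> to every other pair.\<close>

lemma sum_pairs_far:
  assumes "finite (verts H)"
  shows "(\<Sum>P \<in> {P. P \<subseteq> verts H \<and> card P = 2}. enat (1 + (if P \<in> far_pairs H then d else 0)))
    = enat ((card (verts H) choose 2) + d * card (far_pairs H))"
proof -
  let ?A = "{P. P \<subseteq> verts H \<and> card P = 2}"
  have fin: "finite ?A" using assms by auto
  have "far_pairs H = {P \<in> ?A. P \<in> far_pairs H}" by (auto simp: far_pairs_def)
  then have "(\<Sum>P\<in>?A. if P \<in> far_pairs H then d else 0) = d * card (far_pairs H)"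
    using fin by (simp add: sum.If_cases Int_def)
  moreover have "(\<Sum>P\<in>?A. 1 :: nat) = card (verts H) choose 2"
    using n_subsets[OF assms, of 2] by simp
  ultimately have "(\<Sum>P\<in>?A. 1 + (if P \<in> far_pairs H then d else 0))
      = (card (verts H) choose 2) + d * card (far_pairs H)"
    by (simp only: sum.distrib)
  then show ?thesis by (simp only: of_nat_eq_enat[symmetric] of_nat_sum[symmetric])
qed

lemma total_dist_ge:
  assumes "finite (verts H)"
  shows "enat ((card (verts H) choose 2) + card (far_pairs H)) \<le> total_dist H"
proof -
  have "enat (1 + (if P \<in> far_pairs H then 1 else 0)) \<le> pair_dist H P"
    if P: "P \<subseteq> verts H" "card P = 2" for P
  proof -
    obtain u w where uw: "P = {u, w}" "u \<noteq> w" using P by (auto simp: card_2_iff)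
    show ?thesis using hdist_ge_1[of u w H] hdist_ge_2[of u w H] uw
      by (auto simp: pair_dist_doubleton far_pairs_def one_enat_def numeral_2_eq_2)
  qed
  then have "(\<Sum>P \<in> {P. P \<subseteq> verts H \<and> card P = 2}. enat (1 + (if P \<in> far_pairs H then 1 else 0)))
      \<le> total_dist H"
    unfolding total_dist_def by (intro sum_mono) auto
  then show ?thesis using sum_pairs_far[OF assms, of 1] by simp
qed

lemma total_dist_le:
  assumes "finite (verts H)"
    and dist: "\<And>u w. \<lbrakk>u \<in> verts H; w \<in> verts H; u \<noteq> w\<rbrakk> \<Longrightarrow> hdist H u w \<le> enat (Suc d)"
  shows "total_dist H \<le> enat ((card (verts H) choose 2) + d * card (far_pairs H))"
proof -
  have "pair_dist H P \<le> enat (1 + (if P \<in> far_pairs H then d else 0))"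
    if P: "P \<subseteq> verts H" "card P = 2" for P
  proof -
    obtain u w where uw: "P = {u, w}" "u \<noteq> w" using P by (auto simp: card_2_iff)
    show ?thesis
    proof (cases "P \<in> far_pairs H")
      case True
      then show ?thesis using dist[of u w] uw P by (auto simp: pair_dist_doubleton)
    next
      case False
      then obtain e where "e \<in> edges H" "P \<subseteq> e" using P by (auto simp: far_pairs_def)
      with P uw False show ?thesis using hdist_le_1[of e H u w]
        by (auto simp: pair_dist_doubleton one_enat_def)
    qed
  qed
  then have "total_dist H \<le> (\<Sum>P \<in> {P. P \<subseteq> verts H \<and> card P = 2}.
      enat (1 + (if P \<in> far_pairs H then d else 0)))"
    unfolding total_dist_def by (intro sum_mono) auto
  then show ?thesis using sum_pairs_far[OF assms(1), of d] by simp
qed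

lemma total_dist_eq:
  assumes "finite (verts H)"
    and "\<And>u w. \<lbrakk>u \<in> verts H; w \<in> verts H; u \<noteq> w\<rbrakk> \<Longrightarrow> hdist H u w \<le> enat 2"
  shows "total_dist H = enat ((card (verts H) choose 2) + card (far_pairs H))"
  using total_dist_ge[OF assms(1)] total_dist_le[OF assms(1), of 1] assms(2)
  by (simp add: numeral_2_eq_2 antisym)

text \<open>With only two edges, a pair without a common edge has one vertex in each difference.\<close>

lemma card_far_pairs_two_edges:
  assumes "finite (verts H)" "edges H = {a, b}" "verts H = a \<union> b"
  shows "card (far_pairs H) = card (a - b) * card (b - a)"
proof -
  have "far_pairs H = (\<lambda>(x, y). {x, y}) ` ((a - b) \<times> (b - a))" (is "?L = ?R")
  proof
    show "?L \<subseteq> ?R"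
    proof
      fix P assume P: "P \<in> ?L"
      then obtain x y where xy: "P = {x, y}" "x \<noteq> y" by (auto simp: far_pairs_def card_2_iff)
      with P assms have "x \<in> a - b \<and> y \<in> b - a \<or> y \<in> a - b \<and> x \<in> b - a"
        by (auto simp: far_pairs_def)
      then show "P \<in> ?R" using xy by (auto simp: insert_commute image_iff)
    qed
    show "?R \<subseteq> ?L" using assms by (auto simp: far_pairs_def card_2_iff)
  qed
  moreover have "inj_on (\<lambda>(x, y). {x, y}) ((a - b) \<times> (b - a))"
    by (auto simp: inj_on_def doubleton_eq_iff)
  ultimately show ?thesis by (simp add: card_image card_cartesian_product)
qed

section \<open>Deleting a vertex of a Soltes hypergraph\<close>

lemma verts_delete_vertex [simp]: "verts (delete_vertex H v) = verts H - {v}"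
  by (simp add: delete_vertex_def)

lemma edges_delete_vertex [simp]: "edges (delete_vertex H v) = edges H - star H v"
  by (auto simp: delete_vertex_def star_def)

lemma finite_edges:
  assumes "wf_hypergraph H"
  shows "finite (edges H)"
proof (rule finite_subset)
  show "edges H \<subseteq> Pow (verts H)" "finite (Pow (verts H))"
    using assms by (auto simp: wf_hypergraph_def)
qed

lemma star_subset [simp]: "star H v \<subseteq> edges H"
  by (auto simp: star_def)

text \<open>Double counting of incidences.\<close>

lemma sum_card_star:
  assumes "wf_hypergraph H"
  shows "(\<Sum>v\<in>verts H. card (star H v)) = (\<Sum>e\<in>edges H. card e)"
proof -
  have fin: "finite (verts H)" "finite (edges H)"
    using assms finite_edges by (auto simp: wf_hypergraph_def)
  have "(\<Sum>v\<in>verts H. card (star H v)) = (\<Sum>v\<in>verts H. \<Sum>e | e \<in> edges H \<and> v \<in> e. 1)"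
    by (simp add: star_def)
  also have "\<dots> = (\<Sum>e\<in>edges H. \<Sum>v | v \<in> verts H \<and> v \<in> e. 1)"
    using fin by (rule sum.swap_restrict)
  also have "\<dots> = (\<Sum>e\<in>edges H. card e)"
  proof (rule sum.cong)
    fix e assume "e \<in> edges H"
    then have "{v \<in> verts H. v \<in> e} = e" using assms by (auto simp: wf_hypergraph_def)
    then show "(\<Sum>v | v \<in> verts H \<and> v \<in> e. 1) = card e" by simp
  qed simp
  finally show ?thesis .
qed

text \<open>The equality of the two total distances is used only through this inequality. The term
  \<open>card (verts H) - 1\<close> is the number of pairs that contain the deleted vertex.\<close>

lemma soltes_far_pairs:
  assumes H: "soltes H" and v: "v \<in> verts H"
    and dist: "\<And>u w. \<lbrakk>u \<in> verts H - {v}; w \<in> verts H - {v}; u \<noteq> w\<rbrakk>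
      \<Longrightarrow> hdist (delete_vertex H v) u w \<le> enat (Suc d)"
  shows "card (verts H) - 1 + card (far_pairs H) \<le> d * card (far_pairs (delete_vertex H v))"
proof -
  have fin: "finite (verts H)" and n: "card (verts H) \<ge> 2"
    and eq: "total_dist H = total_dist (delete_vertex H v)"
    using H v by (auto simp: soltes_def wf_hypergraph_def)
  obtain k where k: "card (verts H) = Suc k" "card (verts H - {v}) = k"
    using n v fin by (cases "card (verts H)") auto
  have "enat ((card (verts H) choose 2) + card (far_pairs H)) \<le> total_dist H"
    using fin by (rule total_dist_ge)
  also have "\<dots> \<le> enat ((k choose 2) + d * card (far_pairs (delete_vertex H v)))"
    using total_dist_le[of "delete_vertex H v" d] fin dist k by (simp add: eq)
  finally show ?thesis using k by (simp add: numeral_2_eq_2)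
qed

lemma soltes_delete_hdist_finite:
  assumes "soltes H" "v \<in> verts H" "u \<in> verts H - {v}" "w \<in> verts H - {v}" "u \<noteq> w"
  shows "hdist (delete_vertex H v) u w \<noteq> \<infinity>"
proof -
  let ?D = "delete_vertex H v"
  have fin: "finite (verts H)" using assms(1) by (auto simp: soltes_def wf_hypergraph_def)
  have "hdist ?D u w \<le> total_dist ?D"
    unfolding total_dist_def pair_dist_doubleton[symmetric]
    using assms fin by (intro member_le_sum) (auto simp: card_2_iff)
  moreover have "total_dist ?D \<noteq> \<infinity>" using assms by (auto simp: soltes_def)
  ultimately show ?thesis by (metis enat_ord_simps(5))
qed

lemma soltes_far_pairs_remaining:
  assumes H: "soltes H" and v: "v \<in> verts H" and d: "card (edges H - star H v) \<le> Suc d"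
  shows "card (verts H) - 1 + card (far_pairs H) \<le> d * card (far_pairs (delete_vertex H v))"
proof (rule soltes_far_pairs[OF H v])
  fix u w assume uw: "u \<in> verts H - {v}" "w \<in> verts H - {v}" "u \<noteq> w"
  have "finite (edges H - star H v)" using H finite_edges by (auto simp: soltes_def)
  then have "hdist (delete_vertex H v) u w \<le> enat (card (edges H - star H v))"
    using hdist_le_card_edges[OF _ soltes_delete_hdist_finite[OF H v uw]] by simp
  then show "hdist (delete_vertex H v) u w \<le> enat (Suc d)"
    using d by (meson enat_ord_simps(1) order_trans)
qed

text \<open>If the star of \<open>u\<close> is contained in that of \<open>v\<close>, then deleting \<open>v\<close> isolates \<open>u\<close>. A third
  vertex is then at infinite distance from \<open>u\<close>. If there is no third vertex, a single vertex remains,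
  and its total distance 0 is too small.\<close>

lemma soltes_star_antichain:
  assumes H: "soltes H" and uv: "u \<in> verts H" "v \<in> verts H" "u \<noteq> v"
  shows "\<not> star H u \<subseteq> star H v"
proof
  assume sub: "star H u \<subseteq> star H v"
  have fin: "finite (verts H)" and n: "card (verts H) \<ge> 2"
    using H by (auto simp: soltes_def wf_hypergraph_def)
  have iso: "star (delete_vertex H v) u = {}" using sub by (auto simp: star_def)
  show False
  proof (cases "verts H = {u, v}")
    case True
    then have "far_pairs (delete_vertex H v) = {}"
      by (auto simp: far_pairs_def card_2_iff)
    then show False using soltes_far_pairs_remaining[OF H uv(2), of "card (edges H - star H v)"] n
      by simp
  next
    case False
    then obtain w where w: "w \<in> verts H - {v}" "u \<noteq> w" using uv by blast
    then show False
      using hdist_isolated[OF w(2) iso] soltes_delete_hdist_finite[OF H uv(2) _ w] uv by simp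
  qed
qed

lemma soltes_inj_on_star:
  assumes "soltes H"
  shows "inj_on (star H) (verts H)"
  using soltes_star_antichain[OF assms] by (intro inj_onI) blast

text \<open>If \<open>e\<close> is the only edge through \<open>v\<close>, any other vertex of \<open>e\<close> violates the antichain property.
  If at most one edge avoids \<open>v\<close>, all distances after the deletion are at most 1, and the total
  distance has dropped.\<close>

lemma soltes_card_star:
  assumes H: "soltes H" and v: "v \<in> verts H"
  shows "2 \<le> card (star H v)" "card (star H v) + 2 \<le> hsize H"
proof -
  have wf: "wf_hypergraph H" and n: "card (verts H) \<ge> 2" using H by (auto simp: soltes_def)
  have fin: "finite (star H v)"
    using finite_edges[OF wf] star_subset by (rule finite_subset[rotated])
  obtain u where u: "u \<in> verts H" "u \<noteq> v"
    using n v by (metis One_nat_def Suc_1 card_le_Suc0_iff_eq card.infinite not_less_eq_eq zero_le)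
  have "star H v \<noteq> {}" using soltes_star_antichain[OF H v u(1)] u by auto
  moreover have "card (star H v) \<noteq> 1"
  proof
    assume "card (star H v) = 1"
    then obtain e where e: "star H v = {e}" by (auto simp: card_1_singleton_iff)
    then have "card e \<ge> 2" "e \<subseteq> verts H" "e \<in> edges H" using wf
      by (auto simp: star_def wf_hypergraph_def)
    moreover from this have "\<not> e \<subseteq> {v}" using card_mono[of "{v}" e] by auto
    ultimately obtain w where "w \<in> verts H" "w \<in> e" "w \<noteq> v" by blast
    moreover from this have "star H v \<subseteq> star H w"
      unfolding e using \<open>e \<in> edges H\<close> by (simp add: star_def)
    ultimately show False using soltes_star_antichain[OF H v] by blast
  qed
  ultimately show "2 \<le> card (star H v)"
    using fin card_0_eq[of "star H v"] by linarith
  show "card (star H v) + 2 \<le> hsize H"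
  proof (rule ccontr)
    assume "\<not> card (star H v) + 2 \<le> hsize H"
    then have "card (edges H - star H v) \<le> Suc 0"
      using fin by (simp add: card_Diff_subset hsize_def)
    then show False using soltes_far_pairs_remaining[OF H v, of 0] n by simp
  qed
qed

lemma soltes_card_remaining:
  assumes H: "soltes H"
  shows "card (edges H - star H v) = hsize H - card (star H v)"
proof -
  have "finite (edges H)" using H finite_edges by (auto simp: soltes_def)
  then show ?thesis unfolding hsize_def
    by (intro card_Diff_subset) (auto intro: finite_subset[OF star_subset])
qed

text \<open>By the antichain property every vertex other than \<open>v\<close> lies in \<open>a\<close> or \<open>b\<close>, so the sizes of the
  three parts \<open>a - b\<close>, \<open>b - a\<close> and \<open>a \<inter> b\<close> determine the number of vertices, and \<open>p * p\<close> counts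
  the pairs without a common edge after the deletion of \<open>v\<close>.\<close>

lemma soltes_two_remaining_edges:
  assumes H: "soltes H" and r: "\<forall>e\<in>edges H. card e = r"
    and v: "v \<in> verts H" and ab: "edges H - star H v = {a, b}" "a \<noteq> b"
  obtains p c where "card (a - b) = p" "card (b - a) = p" "card (a \<inter> b) = c"
    "r = p + c" "card (verts H) = 1 + 2 * p + c" "2 * p + c + card (far_pairs H) \<le> p * p"
proof -
  have wf: "wf_hypergraph H" and fin: "finite (verts H)"
    using H by (auto simp: soltes_def wf_hypergraph_def)
  have e: "a \<in> edges H" "b \<in> edges H" "v \<notin> a" "v \<notin> b" using ab(1) by (auto simp: star_def)
  then have V: "a \<subseteq> verts H" "b \<subseteq> verts H" using wf by (auto simp: wf_hypergraph_def)
  have Vd: "verts H - {v} = a \<union> b"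
  proof
    show "a \<union> b \<subseteq> verts H - {v}" using V e by auto
    show "verts H - {v} \<subseteq> a \<union> b"
    proof
      fix u assume u: "u \<in> verts H - {v}"
      then obtain f where "f \<in> star H u" "f \<notin> star H v"
        using soltes_star_antichain[OF H _ v] by blast
      then have "f \<in> {a, b}" "u \<in> f" unfolding ab(1)[symmetric] by (auto simp: star_def)
      then show "u \<in> a \<union> b" by auto
    qed
  qed
  have fab: "finite a" "finite b" using V fin finite_subset by auto
  have c1: "card (a - b) + card (a \<inter> b) = r" "card (b - a) + card (a \<inter> b) = r"
    using card_Int_Diff[OF fab(1), of b] card_Int_Diff[OF fab(2), of a] r e
    by (simp_all add: Int_commute)
  have "card (a \<union> b) + card (a \<inter> b) = 2 * r"
    using card_Un_Int[OF fab] r e by simp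
  moreover have "card (verts H) = 1 + card (a \<union> b)"
    using Vd v fin card_Suc_Diff1[OF fin v] by simp
  ultimately have n: "card (verts H) = 1 + 2 * card (a - b) + card (a \<inter> b)"
    using c1 by simp
  have "card (far_pairs (delete_vertex H v)) = card (a - b) * card (b - a)"
    by (rule card_far_pairs_two_edges) (simp_all add: fin fab Vd ab(1))
  moreover have "card (edges H - star H v) \<le> Suc 1" by (simp add: ab)
  ultimately have "card (verts H) - 1 + card (far_pairs H) \<le> card (a - b) * card (b - a)"
    using soltes_far_pairs_remaining[OF H v, of 1] by simp
  then show ?thesis using c1 n by (intro that[of "card (a - b)" "card (a \<inter> b)"]) auto
qed

section \<open>Four edges are not enough\<close>

lemma soltes_card_verts_le:
  assumes H: "soltes H" and k: "\<forall>v\<in>verts H. card (star H v) = k"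
  shows "card (verts H) \<le> hsize H choose k"
proof -
  have fin: "finite (edges H)" using H finite_edges by (auto simp: soltes_def)
  have "card (verts H) \<le> card {X. X \<subseteq> edges H \<and> card X = k}"
    using soltes_inj_on_star[OF H] k fin subsetD[OF star_subset] by (intro card_inj_on_le) auto
  then show ?thesis using n_subsets[OF fin] by (simp add: hsize_def)
qed

text \<open>With four edges every star has size 2, and two edges avoid any given vertex.\<close>

lemma soltes_uniform_hsize_ge_5:
  assumes H: "soltes H" and unif: "uniform H"
  shows "5 \<le> hsize H"
proof (rule ccontr)
  assume "\<not> 5 \<le> hsize H"
  moreover obtain v where v: "v \<in> verts H"
    using H by (force simp: soltes_def)
  ultimately have m: "hsize H = 4" and star: "\<And>v. v \<in> verts H \<Longrightarrow> card (star H v) = 2"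
    using soltes_card_star[OF H] by force+
  obtain r where r: "\<forall>e\<in>edges H. card e = r" using unif by (auto simp: uniform_def)
  have "card (edges H - star H v) = 2" using soltes_card_remaining[OF H] m star v by simp
  then obtain a b where "edges H - star H v = {a, b}" "a \<noteq> b" by (auto simp: card_2_iff)
  then obtain p c where pc: "r = p + c" "card (verts H) = 1 + 2 * p + c"
      "2 * p + c + card (far_pairs H) \<le> p * p"
    using soltes_two_remaining_edges[OF H r v] by metis
  have "2 * card (verts H) = 4 * r"
    using sum_card_star[of H] H r star m by (simp add: soltes_def hsize_def)
  (* 4 * (p + c) = 2 * (1 + 2 * p + c) *)
  then have "c = 1" using pc by simp
  moreover have "card (verts H) \<le> 6"
    using soltes_card_verts_le[OF H, of 2] star m by (simp add: choose_two)
  ultimately have "p \<le> 2" "2 * p + 1 \<le> p * p" using pc by auto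
  moreover have "p * p \<le> 2 * p" using \<open>p \<le> 2\<close> by (intro mult_right_mono) auto
  ultimately show False by simp
qed

section \<open>Five edges: some vertex lies on three of them\<close>

lemma card_far_pairs_add_near:
  assumes wf: "finite (verts H)" "\<forall>e\<in>edges H. e \<subseteq> verts H"
  shows "card (far_pairs H) + card (\<Union>e\<in>edges H. {P. P \<subseteq> e \<and> card P = 2})
    = card (verts H) choose 2"
proof -
  let ?N = "\<Union>e\<in>edges H. {P. P \<subseteq> e \<and> card P = 2}"
  have "far_pairs H \<union> ?N = {P. P \<subseteq> verts H \<and> card P = 2}" "far_pairs H \<inter> ?N = {}"
    using wf by (auto simp: far_pairs_def)
  note split = this
  then have "finite (far_pairs H \<union> ?N)" using wf by simp
  then have "card (far_pairs H \<union> ?N) = card (far_pairs H) + card ?N"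
    using split(2) unfolding finite_Un by (intro card_Un_disjoint) blast+
  then show ?thesis using split(1) n_subsets[OF wf(1), of 2] by simp
qed

text \<open>Two vertices with two common edges would have equal stars. Hence no pair of vertices is counted for
  two different edges. The restriction to a set \<open>F\<close> of edges covers both the whole hypergraph and the
  hypergraph after a deletion.\<close>

lemma soltes_card_near_pairs:
  assumes H: "soltes H" and r: "\<forall>e\<in>edges H. card e = r"
    and star: "\<And>v. v \<in> verts H \<Longrightarrow> card (star H v) = 2" and F: "F \<subseteq> edges H"
  shows "card (\<Union>e\<in>F. {P. P \<subseteq> e \<and> card P = 2}) = card F * (r choose 2)"
proof -
  have wf: "wf_hypergraph H" using H by (auto simp: soltes_def)
  have fin: "finite F" "\<And>e. e \<in> F \<Longrightarrow> finite e" "\<And>e. e \<in> F \<Longrightarrow> e \<subseteq> verts H"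
    using F wf finite_edges[OF wf] finite_subset by (auto simp: wf_hypergraph_def)+
  have "{P. P \<subseteq> e \<and> card P = 2} \<inter> {P. P \<subseteq> f \<and> card P = 2} = {}"
    if ef: "e \<in> F" "f \<in> F" "e \<noteq> f" for e f
  proof (rule ccontr)
    assume "{P. P \<subseteq> e \<and> card P = 2} \<inter> {P. P \<subseteq> f \<and> card P = 2} \<noteq> {}"
    then obtain u w where uw: "{u, w} \<subseteq> e" "{u, w} \<subseteq> f" "u \<noteq> w" by (auto simp: card_2_iff)
    have "star H x = {e, f}" if "x \<in> {u, w}" for x
    proof -
      have "x \<in> verts H" using that uw ef fin(3)[OF ef(1)] by auto
      then have "card (star H x) = 2" by (rule star)
      moreover have "{e, f} \<subseteq> star H x" using that uw ef F by (auto simp: star_def)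
      moreover have "finite (star H x)" using calculation(1) card.infinite by fastforce
      ultimately show ?thesis using ef(3) card_subset_eq[of "star H x" "{e, f}"] by simp
    qed
    then have "star H u = star H w" by simp
    then show False
      using soltes_inj_on_star[OF H] uw fin(3)[OF ef(1)] by (auto dest: inj_onD)
  qed
  then have "card (\<Union>e\<in>F. {P. P \<subseteq> e \<and> card P = 2}) = (\<Sum>e\<in>F. card {P. P \<subseteq> e \<and> card P = 2})"
    using fin by (intro card_UN_disjoint) auto
  also have "\<dots> = (\<Sum>e\<in>F. r choose 2)"
    using fin r F by (intro sum.cong) (auto simp: n_subsets)
  finally show ?thesis by simp
qed

text \<open>Suppose that all stars have size 2, so that the stars are the edges of an \<open>r\<close>-regular simple graph
  on five points; then \<open>r\<close> is even. For \<open>r = 2\<close> (a 5-cycle) the key inequality reads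
  \<open>4 + 5 \<le> 2 * 3\<close>. For \<open>r = 4\<close> (the complete graph) all distances after a deletion are at most 2,
  because any two edges meet, and the inequality reads \<open>9 + 15 \<le> 18\<close>.\<close>

lemma soltes_5_edges_card_star_3:
  assumes H: "soltes H" and r: "\<forall>e\<in>edges H. card e = r" and m: "hsize H = 5"
  shows "\<exists>v\<in>verts H. card (star H v) = 3"
proof (rule ccontr)
  assume no3: "\<not> (\<exists>v\<in>verts H. card (star H v) = 3)"
  have star: "card (star H v) = 2" if "v \<in> verts H" for v
    using soltes_card_star[OF H that] no3 that m by force
  have wf: "wf_hypergraph H" and n2: "card (verts H) \<ge> 2" and fin: "finite (verts H)"
    using H by (auto simp: soltes_def wf_hypergraph_def)
  have V: "\<forall>e\<in>edges H. e \<subseteq> verts H" using wf by (auto simp: wf_hypergraph_def)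
  obtain v where v: "v \<in> verts H" using n2 by force
  let ?D = "delete_vertex H v" and ?n = "card (verts H)"
  have n: "2 * ?n = 5 * r"
    using sum_card_star[OF wf] r star m by (simp add: hsize_def)
  have n10: "?n \<le> 10"
    using soltes_card_verts_le[OF H, of 2] star m by (simp add: choose_two)
  then have "r \<le> 4" "even r" "r \<noteq> 0" using n n2 by presburger+
  then have r24: "r = 2 \<or> r = 4" by presburger
  have m3: "card (edges H - star H v) = 3"
    using soltes_card_remaining[OF H] m star v by simp
  have far: "card (far_pairs H) + 5 * (r choose 2) = ?n choose 2"
    using card_far_pairs_add_near[OF fin V] soltes_card_near_pairs[OF H r star, of "edges H"] m
    by (simp add: hsize_def)
  have farD: "card (far_pairs ?D) + 3 * (r choose 2) = (?n - 1) choose 2"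
    using card_far_pairs_add_near[of ?D] soltes_card_near_pairs[OF H r star, of "edges ?D"] m3 fin v V
    by (auto simp: star_def)
  from r24 show False
  proof
    assume "r = 2"
    then show False using soltes_far_pairs_remaining[OF H v, of 2] n far farD m3
      by (simp add: choose_two)
  next
    assume r4: "r = 4"
    then have n': "?n = 10" using n by simp
    have finE: "finite (edges H)" using finite_edges[OF wf] .
    (* There are as many vertices as 2-subsets of the edge set, so every such subset is a star and
       provides a common vertex of its two edges. *)
    have all: "star H ` verts H = {X. X \<subseteq> edges H \<and> card X = 2}"
    proof (rule card_subset_eq)
      show "finite {X. X \<subseteq> edges H \<and> card X = 2}" using finE by simp
      show "star H ` verts H \<subseteq> {X. X \<subseteq> edges H \<and> card X = 2}"
        using star subsetD[OF star_subset] by auto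
      show "card (star H ` verts H) = card {X. X \<subseteq> edges H \<and> card X = 2}"
        using soltes_inj_on_star[OF H] n' m n_subsets[OF finE, of 2]
        by (simp add: card_image hsize_def choose_two)
    qed
    have "card (verts H) - 1 + card (far_pairs H) \<le> 1 * card (far_pairs ?D)"
    proof (rule soltes_far_pairs[OF H v])
      fix u w assume uw: "u \<in> verts H - {v}" "w \<in> verts H - {v}" "u \<noteq> w"
      obtain e where e: "e \<in> star H u" "e \<notin> star H v"
        using soltes_star_antichain[OF H _ v] uw by blast
      obtain f where f: "f \<in> star H w" "f \<notin> star H v"
        using soltes_star_antichain[OF H _ v] uw by blast
      have ef: "e \<in> edges H" "f \<in> edges H" "u \<in> e" "w \<in> f" using e f by (auto simp: star_def)
      have "\<exists>x\<in>verts H - {v}. x \<in> e \<inter> f"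
      proof (cases "e = f")
        case True
        then show ?thesis using ef uw by auto
      next
        case False
        then have "{e, f} \<in> star H ` verts H" unfolding all using ef by simp
        then obtain x where x: "x \<in> verts H" "star H x = {e, f}" by auto
        then have "x \<in> e \<inter> f" "x \<noteq> v" using e by (auto simp: star_def)
        with x show ?thesis by blast
      qed
      then obtain x where "x \<in> verts H - {v}" "x \<in> e \<inter> f" by blast
      then show "hdist ?D u w \<le> enat (Suc 1)"
        using hdist_le_2[of e ?D f u w x] e f ef uw by (simp add: numeral_2_eq_2)
    qed
    then show False using r4 n' far farD by (simp add: choose_two)
  qed
qed

section \<open>Five edges: the stars are all triples\<close>

text \<open>A singleton \<open>{x}\<close> and a 2-set in the antichain must be complementary, and every further member
  would contain \<open>{x}\<close> or lie in its complement; so an antichain with members of both sizes has only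
  two members.\<close>

lemma antichain_in_3_set:
  assumes U: "card U = 3" and A: "A \<subseteq> Pow U" "\<forall>X\<in>A. card X = 1 \<or> card X = 2"
    and anti: "\<forall>X\<in>A. \<forall>Y\<in>A. X \<subseteq> Y \<longrightarrow> X = Y"
  shows "card A \<le> 3"
    and "card A = 3 \<Longrightarrow> A = {X. X \<subseteq> U \<and> card X = 1} \<or> A = {X. X \<subseteq> U \<and> card X = 2}"
proof -
  let ?L = "\<lambda>k. {X. X \<subseteq> U \<and> card X = k}"
  have fin: "finite U" using U card.infinite by fastforce
  have card_L: "card (?L k) = 3 choose k" and fin_L: "finite (?L k)" for k
    using n_subsets[OF fin] U fin by simp_all
  have "A \<subseteq> ?L 1 \<or> A \<subseteq> ?L 2 \<or> card A \<le> 2"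
  proof (rule ccontr)
    assume "\<not> (A \<subseteq> ?L 1 \<or> A \<subseteq> ?L 2 \<or> card A \<le> 2)"
    then obtain X Y where XY: "X \<in> A" "card X = 1" "Y \<in> A" "card Y = 2" and c: "\<not> card A \<le> 2"
      using A by blast
    obtain x where x: "X = {x}" using XY by (auto simp: card_1_singleton_iff)
    have "x \<notin> Y" using anti XY x by force
    then have Y: "Y = U - {x}"
      using XY x U A fin by (intro card_subset_eq) auto
    have "Z \<in> {X, Y}" if Z: "Z \<in> A" for Z
    proof (cases "x \<in> Z")
      case True
      then show ?thesis using anti XY x Z by auto
    next
      case False
      then have "Z \<subseteq> Y" using A Z Y by auto
      then show ?thesis using anti XY Z by auto
    qed
    then have "A \<subseteq> {X, Y}" by blast
    then have "card A \<le> card {X, Y}" by (intro card_mono) auto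
    also have "\<dots> \<le> 2" by (simp add: card_insert_if)
    finally show False using c by simp
  qed
  moreover have "card (?L 1) = 3" "card (?L 2) = 3" using card_L by (simp_all add: choose_two)
  ultimately show "card A \<le> 3"
    and "card A = 3 \<Longrightarrow> A = ?L 1 \<or> A = ?L 2"
    using card_mono[OF fin_L[of 1], of A] card_mono[OF fin_L[of 2], of A]
      card_subset_eq[OF fin_L[of 1], of A] card_subset_eq[OF fin_L[of 2], of A]
    by linarith+
qed

text \<open>Let \<open>u\<close> lie in \<open>a\<close> only and \<open>w\<close> in \<open>b\<close> only. Then \<open>a\<close> and \<open>b\<close> are not common edges of \<open>u\<close> and
  \<open>w\<close>, so these have no common edge as soon as their stars are disjoint apart from \<open>a\<close> and \<open>b\<close>. This
  reduces lower bounds for the number of pairs without a common edge to counting disjoint subsets of a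
  3-set.\<close>

lemma card_disjoint_le_far_pairs:
  assumes fin: "finite (verts H)" and ab: "a \<subseteq> verts H" "b \<subseteq> verts H" "a \<noteq> b"
  shows "card {(X, Y) \<in> (\<lambda>u. star H u - {a}) ` (a - b) \<times> (\<lambda>u. star H u - {b}) ` (b - a).
      X \<inter> Y = {}} \<le> card (far_pairs H)"
proof -
  let ?D = "{(u, w) \<in> (a - b) \<times> (b - a). (star H u - {a}) \<inter> (star H w - {b}) = {}}"
  have finD: "finite ?D"
    by (rule finite_subset[of _ "verts H \<times> verts H"]) (use fin ab in auto)
  have "card {(X, Y) \<in> (\<lambda>u. star H u - {a}) ` (a - b) \<times> (\<lambda>u. star H u - {b}) ` (b - a).
      X \<inter> Y = {}} \<le> card ((\<lambda>(u, w). (star H u - {a}, star H w - {b})) ` ?D)"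
    using finD by (intro card_mono) auto
  also have "\<dots> \<le> card ?D" using finD by (rule card_image_le)
  also have "\<dots> = card ((\<lambda>(u, w). {u, w}) ` ?D)"
    by (intro card_image[symmetric]) (auto simp: inj_on_def doubleton_eq_iff)
  also have "\<dots> \<le> card (far_pairs H)"
  proof (rule card_mono)
    show "finite (far_pairs H)" using fin by (simp add: far_pairs_def)
    show "(\<lambda>(u, w). {u, w}) ` ?D \<subseteq> far_pairs H"
    proof (clarify)
      fix u w assume uw: "u \<in> a" "u \<notin> b" "w \<in> b" "w \<notin> a"
        and disj: "(star H u - {a}) \<inter> (star H w - {b}) = {}"
      have "\<not> {u, w} \<subseteq> e" if "e \<in> edges H" for e
      proof
        assume "{u, w} \<subseteq> e"
        then have "e \<in> star H u - {a}" "e \<in> star H w - {b}" using uw that by (auto simp: star_def)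
        then show False using disj by blast
      qed
      then show "{u, w} \<in> far_pairs H" using uw ab by (auto simp: far_pairs_def card_2_iff)
    qed
  qed
  finally show ?thesis .
qed

text \<open>Here \<open>v\<close> is a vertex with a star of size 3, \<open>a\<close> and \<open>b\<close> are the two edges that avoid it, and
  \<open>T\<close> is the set of all vertices with a star of size 3. Double counting gives
  \<open>card T = p + 3 * c - 2\<close>, which is compared with what the possible antichains contribute to \<open>T\<close> and
  to the number of pairs without a common edge. Facts about the link of \<open>a\<close>, that is, the stars of
  the vertices in \<open>a - b\<close> with \<open>a\<close> removed, are stated for \<open>f\<close>, \<open>g\<close> with \<open>{f, g} = {a, b}\<close> in order
  to apply to both edges.\<close>

lemma soltes_star_image_eq_triples:
  assumes H: "soltes H" and r: "\<forall>e\<in>edges H. card e = r" and m: "hsize H = 5"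
  shows "star H ` verts H = {X. X \<subseteq> edges H \<and> card X = 3}"
proof -
  have wf: "wf_hypergraph H" and fin: "finite (verts H)" and finE: "finite (edges H)"
    using H finite_edges by (auto simp: soltes_def wf_hypergraph_def)
  have inj: "inj_on (star H) (verts H)" using H by (rule soltes_inj_on_star)
  obtain v where v: "v \<in> verts H" and U: "card (star H v) = 3"
    using soltes_5_edges_card_star_3[OF assms] by blast
  have "card (edges H - star H v) = 2" using soltes_card_remaining[OF H] m U by simp
  then obtain a b where ab: "edges H - star H v = {a, b}" "a \<noteq> b" by (auto simp: card_2_iff)
  have e: "a \<in> edges H" "b \<in> edges H" "v \<notin> a" "v \<notin> b" using ab(1) by (auto simp: star_def)
  then have V: "a \<subseteq> verts H" "b \<subseteq> verts H" using wf by (auto simp: wf_hypergraph_def)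
  obtain p c where p: "card (a - b) = p" "card (b - a) = p" and c: "card (a \<inter> b) = c"
    and rpc: "r = p + c" and n: "card (verts H) = 1 + 2 * p + c"
    and far: "2 * p + c + card (far_pairs H) \<le> p * p"
    using soltes_two_remaining_edges[OF H r v ab] by metis

  let ?T = "{u \<in> verts H. card (star H u) = 3}"
  have k: "card (star H u) = 2 \<or> card (star H u) = 3" if "u \<in> verts H" for u
    using soltes_card_star[OF H that] m by auto
  have "5 * r = (\<Sum>u\<in>verts H. card (star H u))"
    using sum_card_star[OF wf] r m by (simp add: hsize_def)
  also have "\<dots> = (\<Sum>u\<in>verts H. 2 + (if card (star H u) = 3 then 1 else 0))"
    using k by (intro sum.cong) force+
  also have "\<dots> = 2 * card (verts H) + card ?T"
    using fin by (simp only: sum.distrib) (simp add: sum.If_cases Int_def)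
  finally have t: "card ?T + 2 = p + 3 * c" using rpc n by simp
  have T_ge: "card S \<le> card ?T" if "S \<subseteq> ?T" for S
    using that fin by (intro card_mono) auto

  let ?L = "\<lambda>k. {X. X \<subseteq> star H v \<and> card X = k}"
  let ?link = "\<lambda>f g. (\<lambda>u. star H u - {f}) ` (f - g)"
  have star_link: "star H u - {f} \<subseteq> star H v" "card (star H u) = Suc (card (star H u - {f}))"
    "u \<in> verts H"
    if fg: "{f, g} = {a, b}" and u: "u \<in> f - g" for f g u
  proof -
    have f: "f \<in> edges H" "f \<subseteq> verts H" using fg e V by (auto simp: doubleton_eq_iff)
    show "u \<in> verts H" using f u by auto
    have fu: "f \<in> star H u" "g \<notin> star H u" using f u by (auto simp: star_def)
    show "star H u - {f} \<subseteq> star H v"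
      using fu ab(1) fg[symmetric] by (auto simp: star_def)
    show "card (star H u) = Suc (card (star H u - {f}))"
      using fu finE finite_subset[OF star_subset] by (metis card_Suc_Diff1)
  qed
  have link: "card (f - g) \<le> 3"
    "card (f - g) = 3 \<Longrightarrow> ?link f g = ?L 1 \<or> ?link f g = ?L 2"
    if fg: "{f, g} = {a, b}" for f g
  proof -
    have mem: "f \<in> star H u" if "u \<in> f - g" for u
      using that fg e by (auto simp: star_def doubleton_eq_iff)
    have eq: "u = w" if "u \<in> f - g" "w \<in> f - g" "star H u - {f} \<subseteq> star H w - {f}" for u w
    proof (rule ccontr)
      assume "u \<noteq> w"
      moreover have "star H u \<subseteq> star H w" using that mem by blast
      ultimately show False
        using soltes_star_antichain[OF H] star_link(3)[OF fg] that by blast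
    qed
    have inj_link: "inj_on (\<lambda>u. star H u - {f}) (f - g)"
      using eq by (intro inj_onI) blast
    have sub: "?link f g \<subseteq> Pow (star H v)" using star_link(1)[OF fg] by blast
    have cards: "\<forall>X\<in>?link f g. card X = 1 \<or> card X = 2"
      using star_link(2,3)[OF fg] k by force
    have anti: "\<forall>X\<in>?link f g. \<forall>Y\<in>?link f g. X \<subseteq> Y \<longrightarrow> X = Y"
      using eq by blast
    show "card (f - g) \<le> 3"
      "card (f - g) = 3 \<Longrightarrow> ?link f g = ?L 1 \<or> ?link f g = ?L 2"
      using antichain_in_3_set[OF U sub cards anti] card_image[OF inj_link] by simp_all
  qed
  have link_card: "card (star H u) = Suc k" if "{f, g} = {a, b}" "?link f g = ?L k" "u \<in> f - g"
    for f g k u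
  proof -
    have "star H u - {f} \<in> ?L k" unfolding that(2)[symmetric] using that(3) by blast
    then show ?thesis using star_link(2)[OF that(1,3)] by simp
  qed

  have "p \<le> 3" using link(1)[of a b] p by simp
  then consider "p = 0" | "p = 1" | "p = 2" | "p = 3" by linarith
  then have p3: "p = 3"
  proof cases
    case 1
    then show ?thesis using far n H by (simp add: soltes_def)
  next
    case 3
    then have "card ?T = 0" using far t by simp
    then show ?thesis using T_ge[of "{v}"] v U by simp
  qed (use far in auto)
  (* From here on p = 3: there are 7 + c vertices, of which 1 + 3 * c have a star of size 3. *)
  have c3: "c + card (far_pairs H) \<le> 3" and t3: "card ?T = 1 + 3 * c"
    using far t p3 by simp_all

  have not_singletons: "?link f g \<noteq> ?L 1" if fg: "{f, g} = {a, b}" for f g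
  proof
    assume 1: "?link f g = ?L 1"
    have fg': "{g, f} = {a, b}" using fg by (simp add: insert_commute)
    have fgV: "f \<subseteq> verts H" "g \<subseteq> verts H" and v_fg: "v \<notin> g" "f \<noteq> g"
      and gf3: "card (g - f) = 3"
      using fg V e ab(2) p p3 by (auto simp: doubleton_eq_iff)
    let ?P = "{(X, Y) \<in> ?link f g \<times> ?link g f. X \<inter> Y = {}}"
    have P_le: "card ?P \<le> card (far_pairs H)"
      using card_disjoint_le_far_pairs[OF fin fgV v_fg(2)] by simp
    have "finite (?link f g \<times> ?link g f)" using fgV fin by (simp add: finite_subset)
    then have finP: "finite ?P" by (rule finite_subset[rotated]) blast
    obtain x y z where xyz: "star H v = {x, y, z}" "x \<noteq> y" "x \<noteq> z" "y \<noteq> z"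
      using U by (auto simp: card_3_iff)
    from link(2)[OF fg' gf3] show False
    proof
      assume 2: "?link g f = ?L 1"
      (* Four of the six ordered pairs of distinct singletons already exceed the bound 3. *)
      have "{({x}, {y}), ({x}, {z}), ({y}, {x}), ({y}, {z})} \<subseteq> ?P"
        unfolding 1 2 using xyz by auto
      then have "card {({x}, {y}), ({x}, {z}), ({y}, {x}), ({y}, {z})} \<le> card ?P"
        using finP by (rule card_mono[rotated])
      then show False using xyz P_le c3 by simp
    next
      assume 2: "?link g f = ?L 2"
      (* The three complementary pairs exhaust the bound, so c = 0 and v is the only vertex with a
         star of size 3; but the vertices in g - f have such stars, too. *)
      have "{({x}, {y, z}), ({y}, {x, z}), ({z}, {x, y})} \<subseteq> ?P"
        unfolding 1 2 using xyz by auto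
      then have "card {({x}, {y, z}), ({y}, {x, z}), ({z}, {x, y})} \<le> card ?P"
        using finP by (rule card_mono[rotated])
      then have "c = 0" using xyz P_le c3 by simp
      moreover have "insert v (g - f) \<subseteq> ?T"
        using link_card[OF fg' 2] star_link(3)[OF fg'] v U by auto
      then have "card (insert v (g - f)) \<le> card ?T" by (rule T_ge)
      moreover have "card (insert v (g - f)) = 4"
        using v_fg gf3 card.infinite[of "g - f"] by (subst card_insert_disjoint) auto
      ultimately show False using t3 by simp
    qed
  qed
  have 2: "?link a b = ?L 2" "?link b a = ?L 2"
    using link(2)[of a b] link(2)[of b a] not_singletons[of a b] not_singletons[of b a] p p3
    by (auto simp: insert_commute)
  (* A star of size 2 can only come from a vertex in both a and b, hence there is at most one such
     vertex: 7 + c <= 1 + (1 + 3 * c), which together with c <= 3 gives c = 3. *)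
  have star_pair: "star H u = {a, b}" if u: "u \<in> verts H" "card (star H u) = 2" for u
  proof -
    have "u \<notin> a - b" "u \<notin> b - a"
      using link_card[OF refl 2(1), of u] link_card[OF insert_commute 2(2), of u] u by linarith+
    moreover have "u \<noteq> v" using u U by auto
    then obtain f where f: "f \<in> star H u" "f \<notin> star H v"
      using soltes_star_antichain[OF H u(1) v] by blast
    then have "f \<in> {a, b}" "u \<in> f" unfolding ab(1)[symmetric] by (auto simp: star_def)
    ultimately have "{a, b} \<subseteq> star H u" using e by (auto simp: star_def)
    then show ?thesis
      using u ab(2) finite_subset[OF star_subset finE]
      by (intro card_subset_eq[symmetric]) auto
  qed
  have "star H u = {a, b}" if "u \<in> verts H - ?T" for u
    using star_pair[of u] k[of u] that by simp
  then have "card (verts H - ?T) \<le> card {{a, b}}"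
    using inj_on_diff[OF inj] by (intro card_inj_on_le[of "star H"]) auto
  then have "card (verts H) \<le> 1 + card ?T"
    using fin by (simp add: card_Diff_subset)
  then have c_eq: "c = 3" using n t3 c3 p3 by simp
  then have "card ?T = card (verts H)" using n t3 p3 by simp
  then have "?T = verts H" using fin by (intro card_subset_eq) auto
  then have T: "\<forall>u\<in>verts H. card (star H u) = 3" by blast
  show ?thesis
  proof (rule card_subset_eq)
    show "finite {X. X \<subseteq> edges H \<and> card X = 3}" using finE by simp
    show "star H ` verts H \<subseteq> {X. X \<subseteq> edges H \<and> card X = 3}"
      using T subsetD[OF star_subset] by auto
    have "(5 :: nat) choose 3 = 10" by (simp add: numeral_eq_Suc)
    then show "card (star H ` verts H) = card {X. X \<subseteq> edges H \<and> card X = 3}"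
      using n c_eq p3 m n_subsets[OF finE, of 3] by (simp add: card_image[OF inj] hsize_def)
  qed
qed

section \<open>The dual of the complete 3-uniform hypergraph on five vertices\<close>

definition triples :: "nat set set" where
  "triples = {T. T \<subseteq> {1..5} \<and> card T = 3}"

definition triples_at :: "nat \<Rightarrow> nat set set" where
  "triples_at x = {T \<in> triples. x \<in> T}"

lemma verts_dual_K53 [simp]: "verts (dual (complete_uniform 5 3)) = triples"
  by (auto simp: dual_def complete_uniform_def triples_def)

lemma edges_dual_K53 [simp]: "edges (dual (complete_uniform 5 3)) = triples_at ` {1..5}"
  by (auto simp: dual_def complete_uniform_def triples_def triples_at_def)

lemma bij_betw_subsets_card:
  assumes "bij_betw f A B"
  shows "bij_betw ((`) f) {X. X \<subseteq> A \<and> card X = k} {Y. Y \<subseteq> B \<and> card Y = k}"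
proof -
  have card: "card (f ` X) = card X" if "X \<subseteq> A" for X
    using assms that by (meson bij_betw_def card_image inj_on_subset)
  have "bij_betw ((`) f) (Pow A) (Pow B)" using assms by (rule bij_betw_Pow)
  then have "inj_on ((`) f) (Pow A)" "(`) f ` Pow A = Pow B" by (auto simp: bij_betw_def)
  moreover have "(`) f ` {X. X \<subseteq> A \<and> card X = k} = {Y \<in> (`) f ` Pow A. card Y = k}"
    using card by auto
  ultimately show ?thesis
    unfolding bij_betw_def by (auto intro: inj_on_subset)
qed

text \<open>A hypergraph with distinct stars is determined up to isomorphism by the family of its stars. Any
  numbering \<open>f\<close> of the edges induces the isomorphism \<open>u \<mapsto> f ` star H u\<close>.\<close>

lemma isomorphic_dual_K53:
  assumes inj: "inj_on (star H) (verts H)" and wf: "wf_hypergraph H" and m: "hsize H = 5"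
    and img: "star H ` verts H = {X. X \<subseteq> edges H \<and> card X = 3}"
  shows "isomorphic H (dual (complete_uniform 5 3))"
proof -
  obtain f where f: "bij_betw f (edges H) {1..5::nat}"
    using finite_same_card_bij[OF finite_edges[OF wf], of "{1..5::nat}"] m by (auto simp: hsize_def)
  let ?g = "\<lambda>u. f ` star H u"
  have "bij_betw ((`) f) {X. X \<subseteq> edges H \<and> card X = 3} triples"
    unfolding triples_def by (rule bij_betw_subsets_card[OF f])
  moreover have "bij_betw (star H) (verts H) {X. X \<subseteq> edges H \<and> card X = 3}"
    using inj img by (simp add: bij_betw_def)
  ultimately have bij: "bij_betw ?g (verts H) triples"
    using bij_betw_trans by (fastforce simp: comp_def)
  have "?g ` e = triples_at (f e)" if e: "e \<in> edges H" for e
  proof -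
    have sub: "e \<subseteq> verts H" using wf e by (auto simp: wf_hypergraph_def)
    have mem: "f e \<in> ?g u \<longleftrightarrow> u \<in> e" for u
      using e f by (auto simp: star_def bij_betw_def inj_on_def)
    show ?thesis
    proof
      show "?g ` e \<subseteq> triples_at (f e)"
        using bij sub mem by (auto simp: triples_at_def bij_betw_def)
      show "triples_at (f e) \<subseteq> ?g ` e"
      proof
        fix T assume "T \<in> triples_at (f e)"
        then have "T \<in> ?g ` verts H" "f e \<in> T" using bij by (auto simp: triples_at_def bij_betw_def)
        then show "T \<in> ?g ` e" using mem by blast
      qed
    qed
  qed
  then have "(\<lambda>e. ?g ` e) ` edges H = triples_at ` f ` edges H" by (simp add: image_image)
  then show ?thesis using bij f unfolding isomorphic_def by (auto simp: bij_betw_def)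
qed

lemma card_subsets_through:
  assumes "finite A" "x \<in> A"
  shows "card {T. T \<subseteq> A \<and> card T = Suc k \<and> x \<in> T} = (card A - 1) choose k"
proof -
  have "{T. T \<subseteq> A \<and> card T = Suc k \<and> x \<in> T} = insert x ` {S. S \<subseteq> A - {x} \<and> card S = k}" (is "?L = ?R")
  proof
    show "?L \<subseteq> ?R"
    proof
      fix T assume T: "T \<in> ?L"
      then have "T = insert x (T - {x})" "card (T - {x}) = k" by auto
      with T show "T \<in> ?R" by blast
    qed
    show "?R \<subseteq> ?L"
    proof clarify
      fix S assume S: "S \<subseteq> A - {x}"
      then have "finite S" "x \<notin> S" using assms(1) finite_subset by auto
      then show "insert x S \<subseteq> A \<and> card (insert x S) = Suc (card S) \<and> x \<in> insert x S"
        using S assms(2) by auto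
    qed
  qed
  moreover have "inj_on (insert x) {S. S \<subseteq> A - {x} \<and> card S = k}"
    by (auto simp: inj_on_def)
  ultimately show ?thesis using assms n_subsets[of "A - {x}" k] by (simp add: card_image)
qed

lemma finite_triples [simp]: "finite triples"
  unfolding triples_def by simp

lemma card_triples: "card triples = 10"
  unfolding triples_def using n_subsets[of "{1..5::nat}" 3] by (simp add: numeral_eq_Suc)

lemma card_triples_at:
  assumes "x \<in> {1..5}"
  shows "card (triples_at x) = 6"
  using card_subsets_through[of "{1..5::nat}" x 2] assms
  by (simp add: triples_at_def triples_def conj_assoc choose_two numeral_3_eq_3)

lemma card_triples_at_diff:
  assumes "a \<in> {1..5}" "b \<in> {1..5}" "a \<noteq> b"
  shows "card (triples_at a - triples_at b) = 3"
proof -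
  have "triples_at a - triples_at b = {T. T \<subseteq> {1..5} - {b} \<and> card T = Suc 2 \<and> a \<in> T}"
    by (auto simp: triples_at_def triples_def)
  then show ?thesis using card_subsets_through[of "{1..5::nat} - {b}" a 2] assms
    by (simp add: choose_two)
qed

lemma inj_on_triples_at: "inj_on triples_at {1..5}"
proof (rule inj_onI, rule ccontr)
  fix a b :: nat assume "a \<in> {1..5}" "b \<in> {1..5}" "triples_at a = triples_at b" "a \<noteq> b"
  then show False using card_triples_at_diff[of a b] by simp
qed

text \<open>Since 3 + 3 > 5, any two vertices of the dual are adjacent.\<close>

lemma triples_meet:
  assumes "S \<in> triples" "T \<in> triples"
  shows "S \<inter> T \<noteq> {}"
proof
  assume "S \<inter> T = {}"
  then have "card (S \<union> T) = 6" using assms finite_subset[of _ "{1..5::nat}"]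
    by (subst card_Un_disjoint) (auto simp: triples_def)
  moreover have "card (S \<union> T) \<le> card {1..5::nat}"
    using assms by (intro card_mono) (auto simp: triples_def)
  ultimately show False by simp
qed

lemma hdist_dual_K53:
  assumes "S \<in> triples" "T \<in> triples"
  shows "hdist (dual (complete_uniform 5 3)) S T \<le> enat 2"
proof (cases "S = T")
  case True
  then show ?thesis using hdist_refl[of S "dual (complete_uniform 5 3)"] assms by simp
next
  case False
  obtain x where x: "x \<in> S" "x \<in> T" using triples_meet[OF assms] by auto
  then have "x \<in> {1..5}" using assms by (auto simp: triples_def)
  then have "hdist (dual (complete_uniform 5 3)) S T \<le> 1"
    using x assms False by (intro hdist_le_1[of "triples_at x"]) (auto simp: triples_at_def)
  then show ?thesis by (rule order_trans) (simp add: one_enat_def)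
qed

lemma total_dist_dual_K53: "total_dist (dual (complete_uniform 5 3)) = enat 45"
proof -
  let ?H = "dual (complete_uniform 5 3)"
  have "P \<notin> far_pairs ?H" for P
  proof
    assume "P \<in> far_pairs ?H"
    then obtain S T where ST: "S \<in> triples" "T \<in> triples"
      "\<forall>x\<in>{1..5}. \<not> {S, T} \<subseteq> triples_at x"
      by (auto simp: far_pairs_def card_2_iff)
    obtain x where "x \<in> S" "x \<in> T" using triples_meet[OF ST(1,2)] by auto
    moreover from this have "x \<in> {1..5}" using ST by (auto simp: triples_def)
    ultimately show False using ST by (auto simp: triples_at_def)
  qed
  then have "far_pairs ?H = {}" by blast
  then show ?thesis using total_dist_eq[of ?H] hdist_dual_K53 by (simp add: card_triples choose_two)
qed

text \<open>The edges that avoid \<open>v\<close> belong to the two points \<open>a\<close>, \<open>b\<close> outside \<open>v\<close>. They share a vertex,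
  so distances are at most 2, and they have \<open>3 * 3\<close> pairs without a common edge among the 36 pairs:
  \<open>36 + 9 = 45\<close>, the number of all pairs of triples.\<close>

lemma total_dist_delete_dual_K53:
  assumes v: "v \<in> triples"
  shows "total_dist (delete_vertex (dual (complete_uniform 5 3)) v) = enat 45"
proof -
  let ?D = "delete_vertex (dual (complete_uniform 5 3)) v"
  have "v \<subseteq> {1..5}" "card v = 3" using v by (auto simp: triples_def)
  then have "card ({1..5} - v) = 2" by (subst card_Diff_subset) (auto intro: finite_subset)
  then obtain a b where ab: "{1..5} - v = {a, b}" "a \<noteq> b" by (auto simp: card_2_iff)
  then have ab5: "a \<in> {1..5}" "b \<in> {1..5}" by blast+
  have "star (dual (complete_uniform 5 3)) v = triples_at ` v"
    using v \<open>v \<subseteq> {1..5}\<close> by (auto simp: star_def triples_at_def)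
  then have edges: "edges ?D = {triples_at a, triples_at b}"
    using inj_on_image_set_diff[OF inj_on_triples_at, of "{1..5}" v] \<open>v \<subseteq> {1..5}\<close> ab(1) by simp
  have verts: "triples - {v} = triples_at a \<union> triples_at b"
  proof
    show "triples_at a \<union> triples_at b \<subseteq> triples - {v}" using ab by (auto simp: triples_at_def)
    show "triples - {v} \<subseteq> triples_at a \<union> triples_at b"
    proof
      fix T assume T: "T \<in> triples - {v}"
      then have "card T = card v" "T \<noteq> v" using \<open>card v = 3\<close> by (auto simp: triples_def)
      then have "\<not> T \<subseteq> v" using card_subset_eq[of v T] finite_subset[OF \<open>v \<subseteq> {1..5}\<close>] by auto
      then have "T \<inter> ({1..5} - v) \<noteq> {}" using T by (auto simp: triples_def)
      then show "T \<in> triples_at a \<union> triples_at b"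
        unfolding ab(1) using T by (auto simp: triples_at_def)
    qed
  qed
  have "card (far_pairs ?D) = 9"
    using card_far_pairs_two_edges[of ?D "triples_at a" "triples_at b"] edges verts
      card_triples_at_diff[OF ab5 ab(2)] card_triples_at_diff[OF ab5(2,1)] ab(2)
    by (simp del: edges_delete_vertex add: triples_at_def)
  moreover have "hdist ?D S T \<le> enat 2" if ST: "S \<in> triples - {v}" "T \<in> triples - {v}" "S \<noteq> T" for S T
  proof -
    have "triples_at a \<inter> triples_at b \<noteq> {}"
      using card_triples_at[OF ab5(1)] card_triples_at_diff[OF ab5 ab(2)] by (auto dest: Diff_triv)
    then obtain R where R: "R \<in> triples_at a" "R \<in> triples_at b" by blast
    have "\<exists>e\<in>edges ?D. S \<in> e" "\<exists>e\<in>edges ?D. T \<in> e" "\<forall>e\<in>edges ?D. R \<in> e"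
      unfolding edges using R ST(1,2) unfolding verts by blast+
    then obtain e f where "e \<in> edges ?D" "f \<in> edges ?D" "S \<in> e" "T \<in> f" "R \<in> e \<inter> f"
      by blast
    moreover have "{S, T, R} \<subseteq> verts ?D" using ST R verts by auto
    ultimately show ?thesis using ST(3) by (rule hdist_le_2)
  qed
  ultimately show ?thesis
    using total_dist_eq[of ?D] v by (simp add: card_triples choose_two)
qed

lemma soltes_dual_K53: "soltes (dual (complete_uniform 5 3))"
proof -
  let ?H = "dual (complete_uniform 5 3)"
  have "wf_hypergraph ?H"
    using card_triples_at by (auto simp: wf_hypergraph_def triples_at_def)
  moreover have "hconnected ?H"
    unfolding hconnected_def verts_dual_K53
  proof (intro ballI notI)
    fix S T assume "S \<in> triples" "T \<in> triples" "hdist ?H S T = \<infinity>"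
    then show False using hdist_dual_K53[of S T] by simp
  qed
  ultimately show ?thesis
    by (simp add: soltes_def card_triples total_dist_dual_K53 total_dist_delete_dual_K53)
qed

lemma hsize_dual_K53: "hsize (dual (complete_uniform 5 3)) = 5"
  unfolding hsize_def edges_dual_K53 card_image[OF inj_on_triples_at] by simp

theorem theorem10:
  shows "soltes (dual (complete_uniform 5 3)) \<and> uniform (dual (complete_uniform 5 3)) \<and>
    (\<forall>H :: 'a hypergraph. soltes H \<and> uniform H \<longrightarrow>
       hsize (dual (complete_uniform 5 3)) \<le> hsize H) \<and>
    (\<forall>H :: 'a hypergraph. soltes H \<and> uniform H \<and>
       hsize H = hsize (dual (complete_uniform 5 3)) \<longrightarrow>
       isomorphic H (dual (complete_uniform 5 3)))"
proof (intro conjI allI impI)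
  show "soltes (dual (complete_uniform 5 3))" by (rule soltes_dual_K53)
  show "uniform (dual (complete_uniform 5 3))"
    unfolding uniform_def using card_triples_at by auto
next
  fix H :: "'a hypergraph"
  assume "soltes H \<and> uniform H"
  then show "hsize (dual (complete_uniform 5 3)) \<le> hsize H"
    unfolding hsize_dual_K53 by (auto intro: soltes_uniform_hsize_ge_5)
next
  fix H :: "'a hypergraph"
  assume "soltes H \<and> uniform H \<and> hsize H = hsize (dual (complete_uniform 5 3))"
  then have H: "soltes H" and unif: "uniform H" and m: "hsize H = 5"
    using hsize_dual_K53 by auto
  obtain r where "\<forall>e\<in>edges H. card e = r" using unif by (auto simp: uniform_def)
  then have "star H ` verts H = {X. X \<subseteq> edges H \<and> card X = 3}"
    using soltes_star_image_eq_triples[OF H _ m] by blast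
  then show "isomorphic H (dual (complete_uniform 5 3))"
    using isomorphic_dual_K53 soltes_inj_on_star[OF H] H m by (auto simp: soltes_def)
qed

end
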